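(* Let $N$ be a central ideal in a multiplicative Lie algebra $G$, and let $\sigma:\tilde M(G)\to\tilde M(G/N)$ be the natural homomorphism of Schur multipliers. Then $N\subseteq\mathcal{Z}^*(G)$ if and only if $\sigma$ is a monomorphism.
   Context: A multiplicative Lie algebra is a triple $(G,\cdot,\star)$ where $(G,\cdot)$ is a group (not necessarily abelian) and $\star$ is a binary operation on $G$ such that for all $x,y,z\in G$, writing ${}^xy=xyx^{-1}$: (1) $x\star x=1$; (2) $x\star(yz)=(x\star y)\,{}^y(x\star z)$; (3) $(xy)\star z={}^x(y\star z)\,(x\star z)$; (4) $((x\star y)\star{}^yz)((y\star z)\star{}^zx)((z\star x)\star{}^xy)=1$; (5) ${}^z(x\star y)={}^zx\star{}^zy$. An ideal is a normal subgroup $H$ with $x\star y\in H$ for all $x\in G$, $y\in H$; quotients by ideals are multiplicative Lie algebras. Homomorphisms are group homomorphisms preserving $\star$. For ideals $A,B$ of a multiplicative Lie algebra, at least one of which is the whole algebra, ${}^M[A,B]=(A\star B)[A,B]$, where $A\star B$ (resp. $[A,B]$) is the subgroup generated by all $a\star b$ (resp. $[a,b]=aba^{-1}b^{-1}$), $a\in A$, $b\in B$; it is an ideal. $Z(G)$ is the group center, $LZ(G)=\{x\in G: x\star y=1\ \forall y\in G\}$, $\mathcal{Z}(G)=LZ(G)\cap Z(G)$; a central ideal is an ideal contained in $\mathcal{Z}(G)$. A central extension of $G$ is a short exact sequence of multiplicative Lie algebras $1\to\ker\phi\to E\xrightarrow{\phi}G\to1$ with $\ker\phi\subseteq\mathcal{Z}(E)$.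 $\mathcal{Z}^*(G)$ is the intersection of $\phi(\mathcal{Z}(E))$ over all central extensions of $G$. Let $1\to R\to F\xrightarrow{\pi}G\to1$ be a free presentation of $G$ (short exact sequence of multiplicative Lie algebras with $F$ a free multiplicative Lie algebra on a set), and let $S=\pi^{-1}(N)$, so that $1\to S\to F\to G/N\to1$ is a free presentation of $G/N$. The Schur multipliers are $\tilde M(G)=({}^M[F,F]\cap R)/{}^M[R,F]$ and $\tilde M(G/N)=({}^M[F,F]\cap S)/{}^M[S,F]$ (independent of the presentation up to isomorphism), and $\sigma$ is the homomorphism induced by the inclusion ${}^M[F,F]\cap R\subseteq{}^M[F,F]\cap S$. *)

theory Defs
  imports "HOL-Algebra.Generated_Groups"
begin

section \<open>Multiplicative Lie algebras\<close>

record 'a mult_lie = "'a monoid" +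
  star :: "'a \<Rightarrow> 'a \<Rightarrow> 'a"  (infixl \<open>\<star>\<index>\<close> 75)

definition conj_by :: "('a, 'm) monoid_scheme \<Rightarrow> 'a \<Rightarrow> 'a \<Rightarrow> 'a" where
  "conj_by G x y = x \<otimes>\<^bsub>G\<^esub> y \<otimes>\<^bsub>G\<^esub> inv\<^bsub>G\<^esub> x"

locale mult_lie_algebra = group G for G :: "('a, 'm) mult_lie_scheme" (structure) +
  assumes star_closed [intro, simp]:
      "\<lbrakk>x \<in> carrier G; y \<in> carrier G\<rbrakk> \<Longrightarrow> x \<star> y \<in> carrier G"
    and star_self: "x \<in> carrier G \<Longrightarrow> x \<star> x = \<one>"
    and star_mult_right:
      "\<lbrakk>x \<in> carrier G; y \<in> carrier G; z \<in> carrier G\<rbrakk>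
        \<Longrightarrow> x \<star> (y \<otimes> z) = (x \<star> y) \<otimes> conj_by G y (x \<star> z)"
    and star_mult_left:
      "\<lbrakk>x \<in> carrier G; y \<in> carrier G; z \<in> carrier G\<rbrakk>
        \<Longrightarrow> (x \<otimes> y) \<star> z = conj_by G x (y \<star> z) \<otimes> (x \<star> z)"
    and star_jacobi:
      "\<lbrakk>x \<in> carrier G; y \<in> carrier G; z \<in> carrier G\<rbrakk>
        \<Longrightarrow> ((x \<star> y) \<star> conj_by G y z) \<otimes> ((y \<star> z) \<star> conj_by G z x)
            \<otimes> ((z \<star> x) \<star> conj_by G x y) = \<one>"
    and conj_star:
      "\<lbrakk>x \<in> carrier G; y \<in> carrier G; z \<in> carrier G\<rbrakk>
        \<Longrightarrow> conj_by G z (x \<star> y) = conj_by G z x \<star> conj_by G z y"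

definition mlie_hom ::
    "('a, 'm) mult_lie_scheme \<Rightarrow> ('b, 'n) mult_lie_scheme \<Rightarrow> ('a \<Rightarrow> 'b) set" where
  "mlie_hom G H = {h \<in> hom G H. \<forall>x \<in> carrier G. \<forall>y \<in> carrier G. h (x \<star>\<^bsub>G\<^esub> y) = h x \<star>\<^bsub>H\<^esub> h y}"

definition mlie_mon ::
    "('a, 'm) mult_lie_scheme \<Rightarrow> ('b, 'n) mult_lie_scheme \<Rightarrow> ('a \<Rightarrow> 'b) set" where
  "mlie_mon G H = {h \<in> mlie_hom G H. inj_on h (carrier G)}"

definition mlie_epi ::
    "('a, 'm) mult_lie_scheme \<Rightarrow> ('b, 'n) mult_lie_scheme \<Rightarrow> ('a \<Rightarrow> 'b) set" where
  "mlie_epi G H = {h \<in> mlie_hom G H. h ` carrier G = carrier H}"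

definition mlie_ideal :: "'a set \<Rightarrow> ('a, 'm) mult_lie_scheme \<Rightarrow> bool" where
  "mlie_ideal H G \<longleftrightarrow> H \<lhd> G \<and> (\<forall>x \<in> carrier G. \<forall>y \<in> H. x \<star>\<^bsub>G\<^esub> y \<in> H)"

text \<open>The group structure of the quotient is that of \<^const>\<open>FactGroup\<close>; when \<open>I\<close> is an ideal, the
  union defining the star of two cosets consists of copies of a single coset.\<close>

definition mlie_quot :: "('a, 'm) mult_lie_scheme \<Rightarrow> 'a set \<Rightarrow> 'a set mult_lie" where
  "mlie_quot G I =
    \<lparr>carrier = rcosets\<^bsub>G\<^esub> I, monoid.mult = set_mult G, one = I,
     star = (\<lambda>C D. \<Union>x \<in> C. \<Union>y \<in> D. I #>\<^bsub>G\<^esub> (x \<star>\<^bsub>G\<^esub> y))\<rparr>"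

definition star_subgroup :: "('a, 'm) mult_lie_scheme \<Rightarrow> 'a set \<Rightarrow> 'a set \<Rightarrow> 'a set" where
  "star_subgroup G A B = generate G {a \<star>\<^bsub>G\<^esub> b | a b. a \<in> A \<and> b \<in> B}"

definition comm_subgroup :: "('a, 'm) monoid_scheme \<Rightarrow> 'a set \<Rightarrow> 'a set \<Rightarrow> 'a set" where
  "comm_subgroup G A B =
    generate G {a \<otimes>\<^bsub>G\<^esub> b \<otimes>\<^bsub>G\<^esub> inv\<^bsub>G\<^esub> a \<otimes>\<^bsub>G\<^esub> inv\<^bsub>G\<^esub> b | a b. a \<in> A \<and> b \<in> B}"

text \<open>\<open>mlie_comm G A B\<close> is \<open>\<^sup>M[A, B] = (A \<star> B)[A, B]\<close>.\<close>

definition mlie_comm :: "('a, 'm) mult_lie_scheme \<Rightarrow> 'a set \<Rightarrow> 'a set \<Rightarrow> 'a set" where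
  "mlie_comm G A B = star_subgroup G A B <#>\<^bsub>G\<^esub> comm_subgroup G A B"


section \<open>Centers and central extensions\<close>

definition group_center :: "('a, 'm) monoid_scheme \<Rightarrow> 'a set" where
  "group_center G = {x \<in> carrier G. \<forall>y \<in> carrier G. x \<otimes>\<^bsub>G\<^esub> y = y \<otimes>\<^bsub>G\<^esub> x}"

definition lie_center :: "('a, 'm) mult_lie_scheme \<Rightarrow> 'a set" where
  "lie_center G = {x \<in> carrier G. \<forall>y \<in> carrier G. x \<star>\<^bsub>G\<^esub> y = \<one>\<^bsub>G\<^esub>}"

definition mlie_center :: "('a, 'm) mult_lie_scheme \<Rightarrow> 'a set" where
  "mlie_center G = lie_center G \<inter> group_center G"

definition central_ideal :: "'a set \<Rightarrow> ('a, 'm) mult_lie_scheme \<Rightarrow> bool" where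
  "central_ideal N G \<longleftrightarrow> mlie_ideal N G \<and> N \<subseteq> mlie_center G"

definition central_extension ::
    "('e, 'n) mult_lie_scheme \<Rightarrow> ('e \<Rightarrow> 'a) \<Rightarrow> ('a, 'm) mult_lie_scheme \<Rightarrow> bool" where
  "central_extension E \<phi> G \<longleftrightarrow>
    mult_lie_algebra E \<and> mult_lie_algebra G \<and> \<phi> \<in> mlie_epi E G \<and> kernel E G \<phi> \<subseteq> mlie_center E"

text \<open>The intersection ranges over all central extensions \<open>E\<close> of \<open>G\<close>.  A definition in HOL can only
  quantify over the \<open>E\<close> carried by one type, for which \<^typ>\<open>'a list\<close> is used; this loses nothing,
  since lemma \<open>mlie_Zstar_subset\<close> below shows that the result is contained in \<open>\<phi> ` mlie_center E\<close> for
  central extensions \<open>E\<close> carried by an arbitrary type.\<close>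

definition mlie_Zstar :: "('a, 'm) mult_lie_scheme \<Rightarrow> 'a set" where
  "mlie_Zstar G =
    {x \<in> carrier G. \<forall>(E :: 'a list mult_lie) \<phi>. central_extension E \<phi> G \<longrightarrow> x \<in> \<phi> ` mlie_center E}"


section \<open>Free presentations and Schur multipliers\<close>

text \<open>\<open>F\<close> is free on the subset \<open>X\<close> of its carrier.  The test algebras \<open>H\<close> are carried by the one
  type \<^typ>\<open>'f list\<close>; lemmas \<open>mlie_free_on_ex\<close> and \<open>mlie_free_on_unique\<close> below give the universal
  property for \<open>H\<close> carried by an arbitrary type.\<close>

definition mlie_free_on :: "'f set \<Rightarrow> ('f, 'm) mult_lie_scheme \<Rightarrow> bool" where
  "mlie_free_on X F \<longleftrightarrow>
    mult_lie_algebra F \<and> X \<subseteq> carrier F \<and>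
    (\<forall>(H :: 'f list mult_lie) f. mult_lie_algebra H \<and> f \<in> X \<rightarrow> carrier H \<longrightarrow>
      (\<exists>h \<in> mlie_hom F H. (\<forall>x \<in> X. h x = f x) \<and>
        (\<forall>k \<in> mlie_hom F H. (\<forall>x \<in> X. k x = f x) \<longrightarrow> (\<forall>y \<in> carrier F. k y = h y))))"

definition free_presentation ::
    "('f, 'n) mult_lie_scheme \<Rightarrow> ('f \<Rightarrow> 'a) \<Rightarrow> ('a, 'm) mult_lie_scheme \<Rightarrow> bool" where
  "free_presentation F \<pi> G \<longleftrightarrow> (\<exists>X. mlie_free_on X F) \<and> mult_lie_algebra G \<and> \<pi> \<in> mlie_epi F G"

text \<open>The Schur multiplier \<open>(\<^sup>M[F, F] \<inter> R) / \<^sup>M[R, F]\<close> of \<open>F / R\<close>, computed from the free presentation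
  of \<open>F / R\<close> given by \<open>F\<close> and the ideal \<open>R\<close>.\<close>

definition schur_multiplier :: "('f, 'm) mult_lie_scheme \<Rightarrow> 'f set \<Rightarrow> 'f set mult_lie" where
  "schur_multiplier F R =
    mlie_quot (F\<lparr>carrier := mlie_comm F (carrier F) (carrier F) \<inter> R\<rparr>) (mlie_comm F R (carrier F))"

text \<open>For ideals \<open>R \<subseteq> S\<close>, the map \<open>\<^sup>M[R, F] x \<mapsto> \<^sup>M[S, F] x\<close> of Schur multipliers induced by the
  inclusion; it does not depend on \<open>R\<close>.\<close>

definition schur_map :: "('f, 'm) mult_lie_scheme \<Rightarrow> 'f set \<Rightarrow> 'f set \<Rightarrow> 'f set" where
  "schur_map F S C = (\<Union>x \<in> C. mlie_comm F S (carrier F) #>\<^bsub>F\<^esub> x)"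


section \<open>Independence of the carrier types\<close>

unbundle cardinal_syntax

inductive_set mlie_gen :: "('a, 'm) mult_lie_scheme \<Rightarrow> 'a set \<Rightarrow> 'a set"
  for G and S where
    one: "\<one>\<^bsub>G\<^esub> \<in> mlie_gen G S"
  | incl: "x \<in> S \<Longrightarrow> x \<in> mlie_gen G S"
  | inv: "x \<in> mlie_gen G S \<Longrightarrow> inv\<^bsub>G\<^esub> x \<in> mlie_gen G S"
  | mult: "x \<in> mlie_gen G S \<Longrightarrow> y \<in> mlie_gen G S \<Longrightarrow> x \<otimes>\<^bsub>G\<^esub> y \<in> mlie_gen G S"
  | star: "x \<in> mlie_gen G S \<Longrightarrow> y \<in> mlie_gen G S \<Longrightarrow> x \<star>\<^bsub>G\<^esub> y \<in> mlie_gen G S"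

lemma (in mult_lie_algebra) mlie_gen_carrier:
  assumes "S \<subseteq> carrier G" "x \<in> mlie_gen G S"
  shows "x \<in> carrier G"
  using assms(2) by induction (use assms(1) in auto)

lemma mlie_gen_card:
  fixes G :: "('a, 'm) mult_lie_scheme"
  assumes S: "|S| \<le>o |UNIV :: 'c list set|"
  shows "|mlie_gen G S| \<le>o |UNIV :: 'c list set|"
proof -
  let ?B = "UNIV :: 'c list set"
  have inf: "\<not> finite ?B" by (rule infinite_UNIV_listI)
  define step where "step T = T \<union> (\<lambda>x. inv\<^bsub>G\<^esub> x) ` T \<union> (\<lambda>(x, y). x \<otimes>\<^bsub>G\<^esub> y) ` (T \<times> T)
    \<union> (\<lambda>(x, y). x \<star>\<^bsub>G\<^esub> y) ` (T \<times> T)" for T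
  define A where "A n = (step ^^ n) (insert \<one>\<^bsub>G\<^esub> S)" for n
  have un: "|P \<union> Q| \<le>o |?B|" if "|P| \<le>o |?B|" "|Q| \<le>o |?B|" for P Q :: "'a set"
    by (rule card_of_Un_ordLeq_infinite_Field) (use inf that in \<open>auto simp: card_of_card_order_on Field_card_of\<close>)
  have tim: "|P \<times> P| \<le>o |?B|" if "|P| \<le>o |?B|" for P :: "'a set"
    by (rule card_of_Times_ordLeq_infinite_Field) (use inf that in \<open>auto simp: card_of_card_order_on Field_card_of\<close>)
  have im: "|f ` P| \<le>o |?B|" if "|P| \<le>o |?B|" for f :: "'b \<Rightarrow> 'a" and P
    by (rule ordLeq_transitive[OF card_of_image that])
  have sing: "|{\<one>\<^bsub>G\<^esub>}| \<le>o |?B|"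
    by (rule card_of_ordLeqI[of "\<lambda>_. []"]) auto
  have card: "|A n| \<le>o |?B|" for n
  proof (induction n)
    case 0
    show ?case using un[OF sing S] by (simp add: A_def)
  next
    case (Suc n)
    have "A (Suc n) = step (A n)" by (simp add: A_def)
    then show ?case
      unfolding step_def by (simp only:) (intro un im tim Suc)
  qed
  have mono: "A m \<subseteq> A n" if "m \<le> n" for m n
    using that by (rule lift_Suc_mono_le[rotated]) (auto simp: A_def step_def)
  have "x \<in> (\<Union>n. A n)" if "x \<in> mlie_gen G S" for x
    using that
  proof induction
    case one
    have "\<one>\<^bsub>G\<^esub> \<in> A 0" by (simp add: A_def)
    then show ?case by blast
  next
    case (incl x)
    then have "x \<in> A 0" by (simp add: A_def)
    then show ?case by blast
  next
    case (inv x)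
    then obtain n where "x \<in> A n" by blast
    then have "inv\<^bsub>G\<^esub> x \<in> A (Suc n)" by (auto simp: A_def step_def)
    then show ?case by blast
  next
    case (mult x y)
    then obtain m n where "x \<in> A m" "y \<in> A n" by blast
    then have "x \<in> A (max m n)" "y \<in> A (max m n)"
      using mono[of m "max m n"] mono[of n "max m n"] by auto
    then have "x \<otimes>\<^bsub>G\<^esub> y \<in> A (Suc (max m n))" by (force simp: A_def step_def)
    then show ?case by blast
  next
    case (star x y)
    then obtain m n where "x \<in> A m" "y \<in> A n" by blast
    then have "x \<in> A (max m n)" "y \<in> A (max m n)"
      using mono[of m "max m n"] mono[of n "max m n"] by auto
    then have "x \<star>\<^bsub>G\<^esub> y \<in> A (Suc (max m n))" by (force simp: A_def step_def)
    then show ?case by blast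
  qed
  then have "mlie_gen G S \<subseteq> (\<Union>n. A n)" by blast
  then have "|mlie_gen G S| \<le>o |\<Union>n. A n|" by (rule card_of_mono1)
  also have "|\<Union>n. A n| \<le>o |?B|"
    by (rule card_of_UNION_ordLeq_infinite[OF inf])
      (use card inf infinite_iff_card_of_nat in auto)
  finally show ?thesis .
qed

text \<open>A subalgebra with few generators has an isomorphic copy carried by \<^typ>\<open>'c list\<close>.\<close>

lemma mlie_gen_copy:
  fixes H :: "('h, 'm) mult_lie_scheme"
  assumes H: "mult_lie_algebra H" and S: "S \<subseteq> carrier H"
    and card: "|S| \<le>o |UNIV :: 'c list set|"
  obtains K :: "'c list mult_lie" and k where
    "mult_lie_algebra K" "k \<in> mlie_hom K H" "inj_on k (carrier K)" "k ` carrier K = mlie_gen H S"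
proof -
  interpret H: mult_lie_algebra H by (rule H)
  let ?M = "mlie_gen H S"
  have MH: "x \<in> carrier H" if "x \<in> ?M" for x
    using H.mlie_gen_carrier[OF S that] .
  obtain e :: "'h \<Rightarrow> 'c list" where e: "inj_on e ?M"
    using mlie_gen_card[OF card] card_of_ordLeq[of ?M "UNIV :: 'c list set"] by blast
  define k where "k = inv_into ?M e"
  have ke [simp]: "k (e x) = x" if "x \<in> ?M" for x
    using that e by (simp add: k_def)
  have kM [simp]: "k x \<in> ?M" if "x \<in> e ` ?M" for x
    using that by auto
  have kC [simp]: "k x \<in> carrier H" if "x \<in> e ` ?M" for x
    using that MH by auto
  have ek [simp]: "e (k x) = x" if "x \<in> e ` ?M" for x
    using that by auto
  have kinj: "k x = k y \<Longrightarrow> x = y" if "x \<in> e ` ?M" "y \<in> e ` ?M" for x y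
    using that by auto
  define K :: "'c list mult_lie" where
    "K = \<lparr>carrier = e ` ?M, monoid.mult = (\<lambda>x y. e (k x \<otimes>\<^bsub>H\<^esub> k y)), one = e \<one>\<^bsub>H\<^esub>,
          star = (\<lambda>x y. e (k x \<star>\<^bsub>H\<^esub> k y))\<rparr>"
  have cK [simp]: "carrier K = e ` ?M" by (simp add: K_def)
  have k1 [simp]: "k \<one>\<^bsub>K\<^esub> = \<one>\<^bsub>H\<^esub>" by (simp add: K_def mlie_gen.one)
  have km [simp]: "k (x \<otimes>\<^bsub>K\<^esub> y) = k x \<otimes>\<^bsub>H\<^esub> k y" if "x \<in> e ` ?M" "y \<in> e ` ?M" for x y
    unfolding K_def using that kM by (simp add: mlie_gen.mult)
  have ks [simp]: "k (x \<star>\<^bsub>K\<^esub> y) = k x \<star>\<^bsub>H\<^esub> k y" if "x \<in> e ` ?M" "y \<in> e ` ?M" for x y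
    unfolding K_def using that kM by (simp add: mlie_gen.star)
  have c1 [simp]: "\<one>\<^bsub>K\<^esub> \<in> e ` ?M" by (simp add: K_def mlie_gen.one)
  have cm [simp]: "x \<otimes>\<^bsub>K\<^esub> y \<in> e ` ?M" if "x \<in> e ` ?M" "y \<in> e ` ?M" for x y
    unfolding K_def using kM[OF that(1)] kM[OF that(2)] by (simp add: mlie_gen.mult)
  have cs [simp]: "x \<star>\<^bsub>K\<^esub> y \<in> e ` ?M" if "x \<in> e ` ?M" "y \<in> e ` ?M" for x y
    unfolding K_def using kM[OF that(1)] kM[OF that(2)] by (simp add: mlie_gen.star)
  have gK: "group K"
  proof (rule groupI; unfold cK)
    fix x y z assume xyz: "x \<in> e ` ?M" "y \<in> e ` ?M" "z \<in> e ` ?M"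
    show "x \<otimes>\<^bsub>K\<^esub> y \<otimes>\<^bsub>K\<^esub> z = x \<otimes>\<^bsub>K\<^esub> (y \<otimes>\<^bsub>K\<^esub> z)"
      by (rule kinj) (simp_all only: xyz cm km kC H.m_assoc)
  next
    fix x assume x: "x \<in> e ` ?M"
    show "\<one>\<^bsub>K\<^esub> \<otimes>\<^bsub>K\<^esub> x = x"
      by (rule kinj) (simp_all only: x c1 cm km kC k1 H.l_one)
    have i: "inv\<^bsub>H\<^esub> (k x) \<in> ?M" by (rule mlie_gen.inv[OF kM[OF x]])
    show "\<exists>y\<in>e ` ?M. y \<otimes>\<^bsub>K\<^esub> x = \<one>\<^bsub>K\<^esub>"
    proof (rule bexI)
      show ei: "e (inv\<^bsub>H\<^esub> (k x)) \<in> e ` ?M" using i by blast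
      show "e (inv\<^bsub>H\<^esub> (k x)) \<otimes>\<^bsub>K\<^esub> x = \<one>\<^bsub>K\<^esub>"
        by (rule kinj) (simp_all only: x ei c1 cm km kC k1 ke[OF i] H.l_inv)
    qed
  qed (simp_all only: c1 cm)
  interpret K: group K by (rule gK)
  have khom: "k \<in> hom K H" by (rule homI) (simp_all only: cK km kC)
  then interpret k: group_hom K H k by unfold_locales
  have kc: "k (conj_by K x y) = conj_by H (k x) (k y)" "conj_by K x y \<in> e ` ?M"
    if "x \<in> e ` ?M" "y \<in> e ` ?M" for x y
  proof -
    have "inv\<^bsub>K\<^esub> x \<in> e ` ?M" "k (inv\<^bsub>K\<^esub> x) = inv\<^bsub>H\<^esub> (k x)"
      using K.inv_closed[of x] k.hom_inv[of x] that by simp_all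
    then show "k (conj_by K x y) = conj_by H (k x) (k y)" "conj_by K x y \<in> e ` ?M"
      unfolding conj_by_def using that by (simp_all only: cm km)
  qed
  have "mult_lie_algebra K"
  proof (unfold_locales; unfold cK)
    fix x y z assume xyz: "x \<in> e ` ?M" "y \<in> e ` ?M" "z \<in> e ` ?M"
    show "x \<star>\<^bsub>K\<^esub> (y \<otimes>\<^bsub>K\<^esub> z) = (x \<star>\<^bsub>K\<^esub> y) \<otimes>\<^bsub>K\<^esub> conj_by K y (x \<star>\<^bsub>K\<^esub> z)"
      by (rule kinj) (simp_all only: xyz cm cs km ks kc kC H.star_mult_right)
    show "(x \<otimes>\<^bsub>K\<^esub> y) \<star>\<^bsub>K\<^esub> z = conj_by K x (y \<star>\<^bsub>K\<^esub> z) \<otimes>\<^bsub>K\<^esub> (x \<star>\<^bsub>K\<^esub> z)"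
      by (rule kinj) (simp_all only: xyz cm cs km ks kc kC H.star_mult_left)
    show "((x \<star>\<^bsub>K\<^esub> y) \<star>\<^bsub>K\<^esub> conj_by K y z) \<otimes>\<^bsub>K\<^esub> ((y \<star>\<^bsub>K\<^esub> z) \<star>\<^bsub>K\<^esub> conj_by K z x)
            \<otimes>\<^bsub>K\<^esub> ((z \<star>\<^bsub>K\<^esub> x) \<star>\<^bsub>K\<^esub> conj_by K x y) = \<one>\<^bsub>K\<^esub>"
      by (rule kinj) (simp_all only: xyz c1 cm cs k1 km ks kc kC H.star_jacobi)
    show "conj_by K z (x \<star>\<^bsub>K\<^esub> y) = conj_by K z x \<star>\<^bsub>K\<^esub> conj_by K z y"
      by (rule kinj) (simp_all only: xyz cm cs km ks kc kC H.conj_star)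
  next
    fix x assume x: "x \<in> e ` ?M"
    show "x \<star>\<^bsub>K\<^esub> x = \<one>\<^bsub>K\<^esub>"
      by (rule kinj) (simp_all only: x c1 cs k1 ks kC H.star_self)
  qed (simp_all only: cs)
  moreover have "k \<in> mlie_hom K H" using khom by (simp add: mlie_hom_def)
  moreover have "inj_on k (carrier K)" using kinj by (simp add: inj_on_def)
  moreover have "k ` carrier K = ?M" by (force simp: image_image)
  ultimately show ?thesis by (rule that)
qed

lemma mlie_hom_compose:
  assumes "h \<in> mlie_hom F K" "k \<in> mlie_hom K H"
  shows "k \<circ> h \<in> mlie_hom F H"
  using assms unfolding mlie_hom_def hom_def by (auto simp: Pi_iff)

lemma mlie_hom_lift:
  assumes K: "mult_lie_algebra K" and k: "k \<in> mlie_hom K H" "inj_on k (carrier K)"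
    and F: "mult_lie_algebra F"
    and p: "p \<in> mlie_hom F H" "p ` carrier F \<subseteq> k ` carrier K"
  obtains p' where "p' \<in> mlie_hom F K" "\<And>x. x \<in> carrier F \<Longrightarrow> k (p' x) = p x"
proof -
  interpret K: mult_lie_algebra K by (rule K)
  interpret F: mult_lie_algebra F by (rule F)
  define p' where "p' x = inv_into (carrier K) k (p x)" for x
  have kp: "k (p' x) = p x" "p' x \<in> carrier K" if "x \<in> carrier F" for x
  proof -
    have "p x \<in> k ` carrier K" using p(2) that by blast
    then show "k (p' x) = p x" "p' x \<in> carrier K"
      unfolding p'_def by (rule f_inv_into_f, rule inv_into_into)
  qed
  have "p' \<in> mlie_hom F K"
  proof -
    have "p' (x \<otimes>\<^bsub>F\<^esub> y) = p' x \<otimes>\<^bsub>K\<^esub> p' y" "p' (x \<star>\<^bsub>F\<^esub> y) = p' x \<star>\<^bsub>K\<^esub> p' y"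
      if "x \<in> carrier F" "y \<in> carrier F" for x y
      using that k p(1)
      by (auto intro!: inj_onD[OF k(2)] simp: kp mlie_hom_def hom_def)
    then show ?thesis using kp(2) by (auto simp: mlie_hom_def hom_def)
  qed
  then show ?thesis using kp(1) that by blast
qed

lemma card_of_list_UNIV: "|A :: 'a set| \<le>o |UNIV :: 'a list set|"
  by (rule card_of_ordLeqI[of "\<lambda>x. [x]"]) (auto simp: inj_on_def)

lemma mlie_free_on_ex:
  fixes F :: "('f, 'm) mult_lie_scheme" and H :: "('h, 'n) mult_lie_scheme"
  assumes F: "mlie_free_on X F" and H: "mult_lie_algebra H" and f: "f \<in> X \<rightarrow> carrier H"
  shows "\<exists>h \<in> mlie_hom F H. \<forall>x \<in> X. h x = f x"
proof -
  have "|f ` X| \<le>o |UNIV :: 'f list set|"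
    by (rule ordLeq_transitive[OF card_of_image card_of_list_UNIV])
  moreover have "f ` X \<subseteq> carrier H" using f by auto
  ultimately obtain K :: "'f list mult_lie" and k where
    K: "mult_lie_algebra K" and k: "k \<in> mlie_hom K H" "inj_on k (carrier K)"
      "k ` carrier K = mlie_gen H (f ` X)"
    using mlie_gen_copy[OF H] by metis
  define g where "g x = inv_into (carrier K) k (f x)" for x
  have *: "f x \<in> k ` carrier K" if "x \<in> X" for x
    using that k(3) by (simp add: mlie_gen.incl)
  have g: "g \<in> X \<rightarrow> carrier K" "\<And>x. x \<in> X \<Longrightarrow> k (g x) = f x"
    unfolding g_def using inv_into_into[OF *] f_inv_into_f[OF *] by auto
  then obtain h where "h \<in> mlie_hom F K" "\<forall>x \<in> X. h x = g x"
    using F K unfolding mlie_free_on_def by metis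
  then show ?thesis
    using mlie_hom_compose[OF _ k(1)] g(2) by (metis comp_apply)
qed

lemma mlie_free_on_unique:
  fixes F :: "('f, 'm) mult_lie_scheme" and H :: "('h, 'n) mult_lie_scheme"
  assumes F: "mlie_free_on X F" and H: "mult_lie_algebra H"
    and p: "p \<in> mlie_hom F H" and q: "q \<in> mlie_hom F H" and eq: "\<And>x. x \<in> X \<Longrightarrow> p x = q x"
    and y: "y \<in> carrier F"
  shows "p y = q y"
proof -
  let ?S = "p ` carrier F \<union> q ` carrier F"
  have F': "mult_lie_algebra F" "X \<subseteq> carrier F" using F by (auto simp: mlie_free_on_def)
  have "|?S| \<le>o |UNIV :: 'f list set|"
    by (rule card_of_Un_ordLeq_infinite_Field)
      (auto simp: infinite_UNIV_listI card_of_card_order_on Field_card_of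
        intro: ordLeq_transitive[OF card_of_image card_of_list_UNIV])
  moreover have "?S \<subseteq> carrier H" using p q by (auto simp: mlie_hom_def hom_def)
  ultimately obtain K :: "'f list mult_lie" and k where
    K: "mult_lie_algebra K" and k: "k \<in> mlie_hom K H" "inj_on k (carrier K)"
      "k ` carrier K = mlie_gen H ?S"
    using mlie_gen_copy[OF H] by metis
  have "p ` carrier F \<subseteq> k ` carrier K" "q ` carrier F \<subseteq> k ` carrier K"
    unfolding k(3) by (auto intro: mlie_gen.incl)
  then obtain p' q' where p': "p' \<in> mlie_hom F K" "\<And>x. x \<in> carrier F \<Longrightarrow> k (p' x) = p x"
    and q': "q' \<in> mlie_hom F K" "\<And>x. x \<in> carrier F \<Longrightarrow> k (q' x) = q x"
    using mlie_hom_lift[OF K k(1,2) F'(1)] p q by metis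
  have cl: "p' x \<in> carrier K" "q' x \<in> carrier K" if "x \<in> carrier F" for x
    using that p'(1) q'(1) by (auto simp: mlie_hom_def hom_def)
  have eq': "\<forall>x \<in> X. q' x = p' x"
  proof
    fix x assume "x \<in> X"
    then have "x \<in> carrier F" using F'(2) by blast
    then show "q' x = p' x"
      using eq[OF \<open>x \<in> X\<close>] p'(2) q'(2) cl by (metis inj_onD[OF k(2)])
  qed
  have "p' \<in> X \<rightarrow> carrier K" using F'(2) cl by auto
  then obtain h where h: "\<And>r. r \<in> mlie_hom F K \<Longrightarrow> \<forall>x \<in> X. r x = p' x \<Longrightarrow> \<forall>y \<in> carrier F. r y = h y"
    using F K unfolding mlie_free_on_def by metis
  have "p' y = q' y" using h[OF p'(1)] h[OF q'(1) eq'] y by simp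
  then show ?thesis using p'(2) q'(2) y by metis
qed

lemma mlie_center_star_left:
  assumes E: "mult_lie_algebra E" and z: "z \<in> mlie_center E" and y: "y \<in> carrier E"
  shows "y \<star>\<^bsub>E\<^esub> z = \<one>\<^bsub>E\<^esub>"
proof -
  interpret mult_lie_algebra E by (rule E)
  have zc: "z \<in> carrier E" and z1: "\<And>y. y \<in> carrier E \<Longrightarrow> z \<star>\<^bsub>E\<^esub> y = \<one>\<^bsub>E\<^esub>"
    using z by (auto simp: mlie_center_def lie_center_def)
  have "\<one>\<^bsub>E\<^esub> = (y \<otimes>\<^bsub>E\<^esub> z) \<star>\<^bsub>E\<^esub> (y \<otimes>\<^bsub>E\<^esub> z)" using y zc by (simp add: star_self)
  also have "\<dots> = y \<star>\<^bsub>E\<^esub> (y \<otimes>\<^bsub>E\<^esub> z)"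
    using y zc by (simp add: star_mult_left z1 conj_by_def)
  also have "\<dots> = conj_by E y (y \<star>\<^bsub>E\<^esub> z)"
    using y zc by (simp add: star_mult_right star_self conj_by_def)
  finally have "y \<otimes>\<^bsub>E\<^esub> (y \<star>\<^bsub>E\<^esub> z) \<otimes>\<^bsub>E\<^esub> inv\<^bsub>E\<^esub> y = \<one>\<^bsub>E\<^esub>" by (simp add: conj_by_def)
  then have "y \<otimes>\<^bsub>E\<^esub> (y \<star>\<^bsub>E\<^esub> z) = y"
    using y zc by (metis inv_equality inv_inv inv_closed m_closed star_closed)
  then have "y \<otimes>\<^bsub>E\<^esub> (y \<star>\<^bsub>E\<^esub> z) = y \<otimes>\<^bsub>E\<^esub> \<one>\<^bsub>E\<^esub>" using y by simp
  then show ?thesis using y zc Units_l_cancel[of y] by simp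
qed

lemma mlie_Zstar_subset:
  fixes G :: "('a, 'm) mult_lie_scheme" and E :: "('e, 'n) mult_lie_scheme"
  assumes ext: "central_extension E \<phi> G"
  shows "mlie_Zstar G \<subseteq> \<phi> ` mlie_center E"
proof
  fix x assume x: "x \<in> mlie_Zstar G"
  have E: "mult_lie_algebra E" and G: "mult_lie_algebra G" and \<phi>: "\<phi> \<in> mlie_hom E G" "\<phi> ` carrier E = carrier G"
    and ker: "\<And>z. z \<in> carrier E \<Longrightarrow> \<phi> z = \<one>\<^bsub>G\<^esub> \<Longrightarrow> z \<in> mlie_center E"
    using ext by (auto simp: central_extension_def mlie_epi_def kernel_def)
  interpret E: mult_lie_algebra E by (rule E)
  interpret G: mult_lie_algebra G by (rule G)
  have "\<phi> \<in> hom E G" using \<phi>(1) by (simp add: mlie_hom_def)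
  then interpret phi: group_hom E G \<phi> by unfold_locales
  have \<phi>m: "\<phi> (a \<otimes>\<^bsub>E\<^esub> b) = \<phi> a \<otimes>\<^bsub>G\<^esub> \<phi> b" "\<phi> (a \<star>\<^bsub>E\<^esub> b) = \<phi> a \<star>\<^bsub>G\<^esub> \<phi> b"
    if "a \<in> carrier E" "b \<in> carrier E" for a b
    using \<phi>(1) that by (auto simp: mlie_hom_def hom_def)
  define s where "s = inv_into (carrier E) \<phi>"
  have s: "s a \<in> carrier E" "\<phi> (s a) = a" if "a \<in> carrier G" for a
    using that \<phi>(2) unfolding s_def by (metis inv_into_into, metis f_inv_into_f)
  let ?S = "s ` carrier G"
  have "|?S| \<le>o |UNIV :: 'a list set|"
    by (rule ordLeq_transitive[OF card_of_image card_of_list_UNIV])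
  moreover have S: "?S \<subseteq> carrier E" using s by auto
  ultimately obtain K :: "'a list mult_lie" and k where
    K: "mult_lie_algebra K" and k: "k \<in> mlie_hom K E" "inj_on k (carrier K)"
      "k ` carrier K = mlie_gen E ?S"
    using mlie_gen_copy[OF E] by metis
  interpret K: mult_lie_algebra K by (rule K)
  have kc: "k a \<in> carrier E" if "a \<in> carrier K" for a
    using k(1) that by (auto simp: mlie_hom_def hom_def)
  have km: "k (a \<otimes>\<^bsub>K\<^esub> b) = k a \<otimes>\<^bsub>E\<^esub> k b" "k (a \<star>\<^bsub>K\<^esub> b) = k a \<star>\<^bsub>E\<^esub> k b"
    if "a \<in> carrier K" "b \<in> carrier K" for a b
    using k(1) that by (auto simp: mlie_hom_def hom_def)
  have k_hom: "k \<in> hom K E" using k(1) by (simp add: mlie_hom_def)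
  then interpret k: group_hom K E k by unfold_locales
  have lift: "\<exists>d \<in> carrier K. k d = s a" if "a \<in> carrier G" for a
  proof -
    have "s a \<in> k ` carrier K" unfolding k(3) using that by (auto intro: mlie_gen.incl)
    then show ?thesis by force
  qed
  have img: "(\<phi> \<circ> k) ` carrier K = carrier G"
  proof
    show "(\<phi> \<circ> k) ` carrier K \<subseteq> carrier G" using kc \<phi>(2) by auto
    show "carrier G \<subseteq> (\<phi> \<circ> k) ` carrier K"
    proof
      fix a assume a: "a \<in> carrier G"
      then obtain d where "d \<in> carrier K" "k d = s a" using lift by blast
      then show "a \<in> (\<phi> \<circ> k) ` carrier K" using s(2)[OF a] by (metis comp_apply image_eqI)
    qed
  qed
  have kerK: "kernel K G (\<phi> \<circ> k) \<subseteq> mlie_center K"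
  proof
    fix c assume "c \<in> kernel K G (\<phi> \<circ> k)"
    then have c: "c \<in> carrier K" "k c \<in> mlie_center E"
      using ker kc by (auto simp: kernel_def)
    have "c \<otimes>\<^bsub>K\<^esub> d = d \<otimes>\<^bsub>K\<^esub> c" "c \<star>\<^bsub>K\<^esub> d = \<one>\<^bsub>K\<^esub>" if d: "d \<in> carrier K" for d
    proof -
      have "k c \<otimes>\<^bsub>E\<^esub> k d = k d \<otimes>\<^bsub>E\<^esub> k c" "k c \<star>\<^bsub>E\<^esub> k d = \<one>\<^bsub>E\<^esub>"
        using c(2) kc[OF d] by (auto simp: mlie_center_def lie_center_def group_center_def)
      then show "c \<otimes>\<^bsub>K\<^esub> d = d \<otimes>\<^bsub>K\<^esub> c" "c \<star>\<^bsub>K\<^esub> d = \<one>\<^bsub>K\<^esub>"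
        using c(1) d by (auto intro!: inj_onD[OF k(2)] simp: km)
    qed
    then show "c \<in> mlie_center K"
      using c(1) by (auto simp: mlie_center_def lie_center_def group_center_def)
  qed
  have "central_extension K (\<phi> \<circ> k) G"
    using K G img kerK mlie_hom_compose[OF k(1) \<phi>(1)]
    by (simp add: central_extension_def mlie_epi_def)
  then have "x \<in> (\<phi> \<circ> k) ` mlie_center K"
    using x unfolding mlie_Zstar_def by blast
  then obtain c where c: "c \<in> mlie_center K" "x = \<phi> (k c)"
    by auto
  have cK: "c \<in> carrier K" using c by (auto simp: mlie_center_def lie_center_def)
  have "k c \<otimes>\<^bsub>E\<^esub> e = e \<otimes>\<^bsub>E\<^esub> k c \<and> k c \<star>\<^bsub>E\<^esub> e = \<one>\<^bsub>E\<^esub>" if e: "e \<in> carrier E" for e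
  proof -
    have "\<phi> e \<in> carrier G" using \<phi>(2) e by blast
    then obtain d where d: "d \<in> carrier K" "k d = s (\<phi> e)" "\<phi> (k d) = \<phi> e"
      using lift s(2) by metis
    define z where "z = e \<otimes>\<^bsub>E\<^esub> inv\<^bsub>E\<^esub> (k d)"
    have kd: "k d \<in> carrier E" using kc[OF d(1)] .
    have zc: "z \<in> carrier E" using e kd by (simp add: z_def)
    have ez: "e = z \<otimes>\<^bsub>E\<^esub> k d" using e kd by (simp add: z_def E.m_assoc)
    have "\<phi> z = \<one>\<^bsub>G\<^esub>"
    proof -
      have "\<phi> z = \<phi> e \<otimes>\<^bsub>G\<^esub> inv\<^bsub>G\<^esub> (\<phi> (k d))"
        using kd e by (simp add: z_def)
      then show ?thesis using d(3) e by simp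
    qed
    then have z: "z \<in> mlie_center E" by (rule ker[OF zc])
    have zcom: "z \<otimes>\<^bsub>E\<^esub> y = y \<otimes>\<^bsub>E\<^esub> z" if "y \<in> carrier E" for y
      using z that by (auto simp: mlie_center_def group_center_def)
    have ccom: "c \<otimes>\<^bsub>K\<^esub> d = d \<otimes>\<^bsub>K\<^esub> c" and cstar: "c \<star>\<^bsub>K\<^esub> d = \<one>\<^bsub>K\<^esub>"
      using c(1) d(1) by (auto simp: mlie_center_def lie_center_def group_center_def)
    have kcom: "k c \<otimes>\<^bsub>E\<^esub> k d = k d \<otimes>\<^bsub>E\<^esub> k c" and kstar: "k c \<star>\<^bsub>E\<^esub> k d = \<one>\<^bsub>E\<^esub>"
      using ccom cstar km cK d(1) k.hom_one by metis+
    have "k c \<otimes>\<^bsub>E\<^esub> e = z \<otimes>\<^bsub>E\<^esub> (k c \<otimes>\<^bsub>E\<^esub> k d)"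
      using ez zcom zc kc[OF cK] kc[OF d(1)] by (metis E.m_assoc)
    also have "\<dots> = e \<otimes>\<^bsub>E\<^esub> k c"
      using ez zc kc[OF cK] kc[OF d(1)] kcom by (metis E.m_assoc)
    finally have "k c \<otimes>\<^bsub>E\<^esub> e = e \<otimes>\<^bsub>E\<^esub> k c" .
    moreover have "k c \<star>\<^bsub>E\<^esub> e = \<one>\<^bsub>E\<^esub>"
      unfolding ez using zc kc[OF cK] kc[OF d(1)]
      by (simp add: E.star_mult_right kstar mlie_center_star_left[OF E z] conj_by_def)
    ultimately show ?thesis ..
  qed
  then have "k c \<in> mlie_center E"
    using kc[OF cK] by (simp add: mlie_center_def lie_center_def group_center_def)
  then show "x \<in> \<phi> ` mlie_center E" using c(2) by blast
qed

unbundle no cardinal_syntax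

end

theory Submission
  imports Defs "HOL-Algebra.SndIsomorphismGrp"
begin

text \<open>Write \<open>MR\<close>, \<open>MS\<close> for \<open>\<^sup>M[R, F]\<close>, \<open>\<^sup>M[S, F]\<close>.  Since \<open>N\<close> is central, \<open>MS\<close> lies in
  \<open>\<^sup>M[F, F] \<inter> R\<close>, so the kernel of \<open>\<sigma>\<close> is \<open>MS / MR\<close> and \<open>\<sigma>\<close> is injective iff \<open>MS \<subseteq> MR\<close>.
  If \<open>N \<subseteq> \<Z>\<^sup>*(G)\<close>, apply this to the central extension \<open>F / MR\<close> of \<open>G\<close>: the image of \<open>S\<close> in it is
  central, so \<open>MS \<subseteq> MR\<close>.  Conversely, for a central extension \<open>\<phi> : E \<rightarrow> G\<close> freeness lifts \<open>\<pi>\<close> to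
  \<open>h : F \<rightarrow> E\<close>; as \<open>h\<close> maps \<open>R\<close> into the central kernel of \<open>\<phi>\<close>, it kills \<open>MR \<supseteq> MS\<close>.  Hence
  \<open>h(S)\<close> commutes with, and has trivial star with, \<open>h(F)\<close> and thus \<open>E = h(F) ker \<phi>\<close>.\<close>

section \<open>Conjugation and commutators in a group\<close>

lemma (in group) conj_by_closed [simp]:
  "\<lbrakk>x \<in> carrier G; y \<in> carrier G\<rbrakk> \<Longrightarrow> conj_by G x y \<in> carrier G"
  by (simp add: conj_by_def)

lemma (in group) conj_by_mult:
  "\<lbrakk>x \<in> carrier G; y \<in> carrier G; z \<in> carrier G\<rbrakk>
    \<Longrightarrow> conj_by G x (y \<otimes> z) = conj_by G x y \<otimes> conj_by G x z"
  by (simp add: conj_by_def m_assoc inv_solve_left)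

lemma (in group) conj_by_inv:
  "\<lbrakk>x \<in> carrier G; y \<in> carrier G\<rbrakk> \<Longrightarrow> conj_by G x (inv y) = inv (conj_by G x y)"
  by (simp add: conj_by_def m_assoc inv_mult_group)

lemma (in group_hom) hom_conj_by:
  "\<lbrakk>x \<in> carrier G; y \<in> carrier G\<rbrakk> \<Longrightarrow> h (conj_by G x y) = conj_by H (h x) (h y)"
  by (simp add: conj_by_def)

lemma (in group) commutator_eq_one_iff:
  assumes "x \<in> carrier G" "y \<in> carrier G"
  shows "x \<otimes> y \<otimes> inv x \<otimes> inv y = \<one> \<longleftrightarrow> x \<otimes> y = y \<otimes> x"
proof -
  have "x \<otimes> y \<otimes> inv x \<otimes> inv y = x \<otimes> y \<otimes> inv (y \<otimes> x)"
    using assms by (simp add: inv_mult_group m_assoc)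
  then show ?thesis
    using assms by (metis inv_closed inv_equality inv_inv m_closed r_inv)
qed

section \<open>Homomorphisms, ideals and the center\<close>

lemma mlie_homD:
  assumes "h \<in> mlie_hom G H"
  shows "h \<in> hom G H"
    and "x \<in> carrier G \<Longrightarrow> y \<in> carrier G \<Longrightarrow> h (x \<star>\<^bsub>G\<^esub> y) = h x \<star>\<^bsub>H\<^esub> h y"
  using assms by (auto simp: mlie_hom_def)

lemma mlie_idealD:
  assumes "mlie_ideal I G"
  shows "I \<lhd> G" "subgroup I G" "I \<subseteq> carrier G"
    and "x \<in> carrier G \<Longrightarrow> y \<in> I \<Longrightarrow> x \<star>\<^bsub>G\<^esub> y \<in> I"
  using assms
  by (auto simp: mlie_ideal_def dest: normal_imp_subgroup subgroup.subset)

lemma mlie_center_iff: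
  "x \<in> mlie_center G \<longleftrightarrow> x \<in> carrier G \<and>
    (\<forall>y \<in> carrier G. x \<otimes>\<^bsub>G\<^esub> y = y \<otimes>\<^bsub>G\<^esub> x \<and> x \<star>\<^bsub>G\<^esub> y = \<one>\<^bsub>G\<^esub>)"
  by (auto simp: mlie_center_def lie_center_def group_center_def)

section \<open>Antisymmetry of the star and closure properties\<close>

context mult_lie_algebra
begin

text \<open>Expanding \<open>(x \<otimes> y) \<star> (x \<otimes> y) = \<one>\<close> by both
  product rules leaves only the conjugate by \<open>x\<close> of
  \<open>(y \<star> x) \<otimes> (x \<star> y)\<close>, so that product is trivial.\<close>

lemma star_swap:
  assumes x: "x \<in> carrier G" and y: "y \<in> carrier G"
  shows "x \<star> y = inv (y \<star> x)"
proof -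
  let ?z = "(y \<star> x) \<otimes> (x \<star> y)"
  have "\<one> = (x \<otimes> y) \<star> (x \<otimes> y)" using x y by (simp add: star_self)
  also have "\<dots> = conj_by G x (y \<star> (x \<otimes> y)) \<otimes> (x \<star> (x \<otimes> y))"
    using x y by (simp add: star_mult_left)
  also have "\<dots> = conj_by G x (y \<star> x) \<otimes> conj_by G x (x \<star> y)"
    using x y by (simp add: star_mult_right star_self conj_by_def)
  also have "\<dots> = conj_by G x ?z" using x y by (simp add: conj_by_mult)
  finally have "x \<otimes> ?z = x"
    using x y unfolding conj_by_def by (metis inv_equality inv_inv inv_closed m_closed star_closed)
  then have "?z = \<one>" using x y by simp
  then show ?thesis
    using x y by (metis inv_equality inv_inv inv_closed star_closed)
qed

lemma mlie_center_mult:
  assumes x: "x \<in> mlie_center G" and y: "y \<in> mlie_center G"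
  shows "x \<otimes> y \<in> mlie_center G"
proof -
  have c: "x \<in> carrier G" "y \<in> carrier G" using x y by (auto simp: mlie_center_iff)
  have "x \<otimes> y \<otimes> z = z \<otimes> (x \<otimes> y)" "(x \<otimes> y) \<star> z = \<one>" if z: "z \<in> carrier G" for z
  proof -
    have xz: "x \<otimes> z = z \<otimes> x" "y \<otimes> z = z \<otimes> y" "x \<star> z = \<one>" "y \<star> z = \<one>"
      using x y z by (auto simp: mlie_center_iff)
    have "x \<otimes> y \<otimes> z = x \<otimes> z \<otimes> y" using c z xz(2) by (simp add: m_assoc)
    then show "x \<otimes> y \<otimes> z = z \<otimes> (x \<otimes> y)" using c z xz(1) by (simp add: m_assoc)
    show "(x \<otimes> y) \<star> z = \<one>" using c z xz by (simp add: star_mult_left conj_by_def)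
  qed
  then show ?thesis using c by (simp add: mlie_center_iff)
qed

text \<open>Ideals are defined by absorption in the right argument of the star;
  \<open>star_swap\<close> moves this to the left argument at the cost of an inverse.\<close>

lemma mlie_ideal_star_left:
  assumes "mlie_ideal I G" "x \<in> I" "y \<in> carrier G"
  shows "x \<star> y \<in> I"
  using star_swap[of x y] mlie_idealD[OF assms(1)] assms(2,3)
  by (metis subgroup.m_inv_closed subgroup.mem_carrier)

lemma conj_by_ideal:
  assumes "I \<lhd> G" "x \<in> carrier G" "y \<in> I"
  shows "conj_by G x y \<in> I"
  using normal.inv_op_closed2[OF assms] by (simp add: conj_by_def)

section \<open>The commutator ideal \<open>mlie_comm\<close>\<close>

lemma star_set_carrier:
  assumes "A \<subseteq> carrier G" "B \<subseteq> carrier G"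
  shows "{a \<star> b | a b. a \<in> A \<and> b \<in> B} \<subseteq> carrier G"
  using assms by auto

lemma comm_set_carrier:
  assumes "A \<subseteq> carrier G" "B \<subseteq> carrier G"
  shows "{a \<otimes> b \<otimes> inv a \<otimes> inv b | a b. a \<in> A \<and> b \<in> B} \<subseteq> carrier G"
  using assms by (auto simp: subset_iff)

lemma mlie_comm_generators:
  assumes A: "A \<subseteq> carrier G" and B: "B \<subseteq> carrier G" and a: "a \<in> A" and b: "b \<in> B"
  shows "a \<star> b \<in> mlie_comm G A B" "a \<otimes> b \<otimes> inv a \<otimes> inv b \<in> mlie_comm G A B"
proof -
  have ab: "a \<in> carrier G" "b \<in> carrier G" using assms by auto
  have "a \<star> b \<in> star_subgroup G A B"
    unfolding star_subgroup_def by (rule generate.incl) (use a b in blast)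
  moreover have "\<one> \<in> comm_subgroup G A B"
    unfolding comm_subgroup_def by (rule generate.one)
  ultimately show "a \<star> b \<in> mlie_comm G A B"
    using ab unfolding mlie_comm_def set_mult_def by force
  have "a \<otimes> b \<otimes> inv a \<otimes> inv b \<in> comm_subgroup G A B"
    unfolding comm_subgroup_def by (rule generate.incl) (use a b in blast)
  moreover have "\<one> \<in> star_subgroup G A B"
    unfolding star_subgroup_def by (rule generate.one)
  ultimately have "\<one> \<otimes> (a \<otimes> b \<otimes> inv a \<otimes> inv b) \<in> mlie_comm G A B"
    unfolding mlie_comm_def set_mult_def by blast
  then show "a \<otimes> b \<otimes> inv a \<otimes> inv b \<in> mlie_comm G A B" using ab by simp
qed

text \<open>\<open>mlie_comm\<close> is the product of two generated subgroups; a subgroup that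
  contains both sets of generators contains both factors and hence their product. All upper bounds
  for \<open>mlie_comm\<close> go through this rule.\<close>

lemma mlie_comm_least:
  assumes H: "subgroup H G"
    and "\<And>a b. a \<in> A \<Longrightarrow> b \<in> B \<Longrightarrow> a \<star> b \<in> H"
    and "\<And>a b. a \<in> A \<Longrightarrow> b \<in> B \<Longrightarrow> a \<otimes> b \<otimes> inv a \<otimes> inv b \<in> H"
  shows "mlie_comm G A B \<subseteq> H"
proof -
  have "star_subgroup G A B \<subseteq> H" "comm_subgroup G A B \<subseteq> H"
    unfolding star_subgroup_def comm_subgroup_def
    by (rule generate_subgroup_incl[OF _ H], use assms in blast)+
  then show ?thesis
    using subgroup.m_closed[OF H] unfolding mlie_comm_def set_mult_def by auto
qed

text \<open>Conjugation respects the star (\<open>conj_star\<close>) and commutators, and it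
  preserves \<open>R\<close>, so it permutes the generators of each factor. Both factors are
  therefore normal, and so is their product.\<close>

lemma mlie_comm_normal:
  assumes R: "mlie_ideal R G"
  shows "mlie_comm G R (carrier G) \<lhd> G"
proof -
  note R' = mlie_idealD[OF R]
  have "star_subgroup G R (carrier G) \<lhd> G"
    unfolding star_subgroup_def
  proof (rule normal_generateI)
    show "{a \<star> b | a b. a \<in> R \<and> b \<in> carrier G} \<subseteq> carrier G"
      by (rule star_set_carrier) (use R' in auto)
    fix h g assume "h \<in> {a \<star> b | a b. a \<in> R \<and> b \<in> carrier G}" and g: "g \<in> carrier G"
    then obtain a b where ab: "h = a \<star> b" "a \<in> R" "b \<in> carrier G" by blast
    then have "g \<otimes> h \<otimes> inv g = conj_by G g a \<star> conj_by G g b"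
      using g R'(3) conj_star[of a b g] by (auto simp: conj_by_def)
    moreover have "conj_by G g a \<in> R" using conj_by_ideal[OF R'(1) g] ab by simp
    ultimately show "g \<otimes> h \<otimes> inv g \<in> {a \<star> b | a b. a \<in> R \<and> b \<in> carrier G}"
      using g ab conj_by_closed by blast
  qed
  moreover have "comm_subgroup G R (carrier G) \<lhd> G"
    unfolding comm_subgroup_def
  proof (rule normal_generateI)
    let ?C = "{a \<otimes> b \<otimes> inv a \<otimes> inv b | a b. a \<in> R \<and> b \<in> carrier G}"
    show "?C \<subseteq> carrier G"
      by (rule comm_set_carrier) (use R' in auto)
    fix h g assume "h \<in> ?C" and g: "g \<in> carrier G"
    then obtain a b where ab: "h = a \<otimes> b \<otimes> inv a \<otimes> inv b" "a \<in> R" "b \<in> carrier G" by blast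
    have a: "a \<in> carrier G" using ab R'(3) by auto
    have "g \<otimes> h \<otimes> inv g = conj_by G g h" by (simp add: conj_by_def)
    also have "\<dots> = conj_by G g a \<otimes> conj_by G g b \<otimes> inv (conj_by G g a) \<otimes> inv (conj_by G g b)"
      using g a ab by (simp add: conj_by_mult conj_by_inv)
    finally show "g \<otimes> h \<otimes> inv g \<in> ?C"
      using g ab conj_by_closed conj_by_ideal[OF R'(1) g] by blast
  qed
  ultimately show ?thesis
    unfolding mlie_comm_def by (rule normal_subgroup_set_mult_closed)
qed

lemma mlie_comm_subset_ideal:
  assumes R: "mlie_ideal R G"
  shows "mlie_comm G R (carrier G) \<subseteq> R"
proof (rule mlie_comm_least)
  note R' = mlie_idealD[OF R]
  show "subgroup R G" by (rule R')
  fix a b assume ab: "a \<in> R" "b \<in> carrier G"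
  show "a \<star> b \<in> R" by (rule mlie_ideal_star_left[OF R ab])
  \<comment> \<open>The commutator is regrouped as \<open>a\<close> times the conjugate of
    \<open>inv a\<close> by \<open>b\<close>, both of which lie in \<open>R\<close>.\<close>
  have "conj_by G b (inv a) \<in> R"
    using conj_by_ideal[OF R'(1)] subgroup.m_inv_closed[OF R'(2)] ab by blast
  then have "a \<otimes> conj_by G b (inv a) \<in> R" using subgroup.m_closed[OF R'(2)] ab by blast
  moreover have "a \<in> carrier G" using ab R'(3) by auto
  ultimately show "a \<otimes> b \<otimes> inv a \<otimes> inv b \<in> R" using ab by (simp add: conj_by_def m_assoc)
qed

text \<open>An element \<open>y\<close> of the commutator ideal already lies in \<open>R\<close>, so
  \<open>y \<star> x\<close> is itself a generator; \<open>star_swap\<close> then handles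
  \<open>x \<star> y\<close>.\<close>

lemma mlie_comm_ideal:
  assumes R: "mlie_ideal R G"
  shows "mlie_ideal (mlie_comm G R (carrier G)) G"
  unfolding mlie_ideal_def
proof (intro conjI ballI)
  let ?M = "mlie_comm G R (carrier G)"
  show N: "?M \<lhd> G" by (rule mlie_comm_normal[OF R])
  fix x y assume x: "x \<in> carrier G" and y: "y \<in> ?M"
  have yR: "y \<in> R" using y mlie_comm_subset_ideal[OF R] by blast
  then have yc: "y \<in> carrier G" using mlie_idealD(3)[OF R] by blast
  have "y \<star> x \<in> ?M" using mlie_comm_generators(1)[OF _ subset_refl yR x] mlie_idealD(3)[OF R] .
  then show "x \<star> y \<in> ?M"
    using star_swap[OF x yc] subgroup.m_inv_closed[OF normal_imp_subgroup[OF N]] by simp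
qed

lemma mlie_ideal_carrier: "mlie_ideal (carrier G) G"
  by (simp add: mlie_ideal_def normal_self)

lemma mlie_comm_mono:
  assumes "A \<subseteq> A'" "A' \<subseteq> carrier G" "B \<subseteq> carrier G" "subgroup (mlie_comm G A' B) G"
  shows "mlie_comm G A B \<subseteq> mlie_comm G A' B"
  using assms mlie_comm_generators[OF assms(2,3)] by (intro mlie_comm_least) auto

section \<open>Cosets of an ideal and the quotient algebra\<close>

lemma rcoset_eq_iff:
  assumes "subgroup I G" "x \<in> carrier G" "y \<in> carrier G"
  shows "I #> x = I #> y \<longleftrightarrow> x \<otimes> inv y \<in> I"
  using assms repr_independence[of x I y] rcos_self[of x I]
    subgroup.rcos_module[OF assms(1) group_axioms, of y x] by auto

text \<open>This makes the star of cosets well defined. The two representatives are replaced one at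
  a time, passing through \<open>x' \<star> y\<close>.\<close>

lemma star_rcoset:
  assumes I: "mlie_ideal I G" and x: "x \<in> carrier G" "x' \<in> I #> x" and y: "y \<in> carrier G" "y' \<in> I #> y"
  shows "I #> (x' \<star> y') = I #> (x \<star> y)"
proof -
  note I' = mlie_idealD[OF I]
  interpret normal I G by (rule I')
  obtain i j where ij: "i \<in> I" "j \<in> I" "x' = i \<otimes> x" "y' = j \<otimes> y"
    using x(2) y(2) by (auto simp: r_coset_def)
  have ijc: "i \<in> carrier G" "j \<in> carrier G" using ij by auto
  let ?k = "x' \<star> j"
  have x'c: "x' \<in> carrier G" using ij x ijc by simp
  have k: "?k \<in> I" using I'(4)[OF x'c] ij by simp
  \<comment> \<open>With \<open>u = x' \<star> y\<close> this is the commutator of \<open>j\<close>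
    and \<open>u\<close>, that is, \<open>j\<close> times the conjugate of \<open>inv j\<close> by
    \<open>u\<close>; normality of \<open>I\<close> applies.\<close>
  have c: "conj_by G j (x' \<star> y) \<otimes> inv (x' \<star> y) \<in> I"
  proof -
    have "conj_by G (x' \<star> y) (inv j) \<in> I"
      using conj_by_ideal[OF I'(1)] x'c y ij by simp
    then have "j \<otimes> conj_by G (x' \<star> y) (inv j) \<in> I" using ij by simp
    then show ?thesis using ijc x'c y by (simp add: conj_by_def m_assoc)
  qed
  have "x' \<star> y' = ?k \<otimes> conj_by G j (x' \<star> y)"
    unfolding ij(4) using ijc x'c y by (simp add: star_mult_right)
  then have "(x' \<star> y') \<otimes> inv (x' \<star> y) = ?k \<otimes> (conj_by G j (x' \<star> y) \<otimes> inv (x' \<star> y))"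
    using x'c y ijc by (simp add: m_assoc)
  also have "\<dots> \<in> I" using k c by simp
  finally have 1: "I #> (x' \<star> y') = I #> (x' \<star> y)"
    using x'c y ij ijc by (subst rcoset_eq_iff[OF I'(2)]) simp_all
  \<comment> \<open>Now the left representative is replaced. Here the error term
    \<open>i \<star> y\<close> is moved inside a conjugate by \<open>x \<star> y\<close>, where
    normality absorbs it.\<close>
  have "x' \<star> y = conj_by G i (x \<star> y) \<otimes> (i \<star> y)"
    unfolding ij(3) using ijc x y by (simp add: star_mult_left)
  then have "(x' \<star> y) \<otimes> inv (x \<star> y)
      = i \<otimes> conj_by G (x \<star> y) (inv i \<otimes> (i \<star> y))"
    using ijc x y by (simp add: conj_by_def m_assoc)
  moreover have "conj_by G (x \<star> y) (inv i \<otimes> (i \<star> y)) \<in> I"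
    using conj_by_ideal[OF I'(1)] x y ij mlie_ideal_star_left[OF I] by simp
  ultimately have "(x' \<star> y) \<otimes> inv (x \<star> y) \<in> I" using ij by simp
  then show ?thesis
    using 1 x'c x y by (simp add: rcoset_eq_iff[OF I'(2)])
qed

end

text \<open>The axioms of the star are identities, so they pass to a surjective image. For the
  quotient this avoids checking them on unions of cosets.\<close>

lemma mlie_algebra_epi_image:
  assumes G: "mult_lie_algebra G" and H: "group H" and q: "q \<in> mlie_epi G H"
  shows "mult_lie_algebra H"
proof -
  interpret G: mult_lie_algebra G by (rule G)
  interpret H: group H by (rule H)
  have q': "q \<in> mlie_hom G H" "carrier H = q ` carrier G" using q by (auto simp: mlie_epi_def)
  interpret q: group_hom G H q using mlie_homD(1)[OF q'(1)] by unfold_locales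
  note s = mlie_homD(2)[OF q'(1), symmetric]
  \<comment> \<open>The homomorphism rules are reversed so that each side of an axiom becomes
    \<open>q\<close> of a term in \<open>G\<close>; \<open>hom_mult\<close> in its usual direction
    must then be removed from the simpset.\<close>
  note t = q.hom_mult[symmetric] q.hom_conj_by[symmetric] s
  show ?thesis
  proof (unfold_locales; unfold q'(2); (elim imageE; hypsubst)?)
    fix x y assume "x \<in> carrier G" "y \<in> carrier G"
    then show "q x \<star>\<^bsub>H\<^esub> q y \<in> q ` carrier G" by (simp add: s)
  next
    fix x assume "x \<in> carrier G"
    then show "q x \<star>\<^bsub>H\<^esub> q x = \<one>\<^bsub>H\<^esub>" by (simp add: s G.star_self)
  next
    fix x y z assume xyz: "x \<in> carrier G" "y \<in> carrier G" "z \<in> carrier G"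
    show "q x \<star>\<^bsub>H\<^esub> (q y \<otimes>\<^bsub>H\<^esub> q z) = (q x \<star>\<^bsub>H\<^esub> q y) \<otimes>\<^bsub>H\<^esub> conj_by H (q y) (q x \<star>\<^bsub>H\<^esub> q z)"
      using xyz by (simp add: t G.star_mult_right del: q.hom_mult)
    show "(q x \<otimes>\<^bsub>H\<^esub> q y) \<star>\<^bsub>H\<^esub> q z = conj_by H (q x) (q y \<star>\<^bsub>H\<^esub> q z) \<otimes>\<^bsub>H\<^esub> (q x \<star>\<^bsub>H\<^esub> q z)"
      using xyz by (simp add: t G.star_mult_left del: q.hom_mult)
    show "((q x \<star>\<^bsub>H\<^esub> q y) \<star>\<^bsub>H\<^esub> conj_by H (q y) (q z)) \<otimes>\<^bsub>H\<^esub> ((q y \<star>\<^bsub>H\<^esub> q z) \<star>\<^bsub>H\<^esub> conj_by H (q z) (q x))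
            \<otimes>\<^bsub>H\<^esub> ((q z \<star>\<^bsub>H\<^esub> q x) \<star>\<^bsub>H\<^esub> conj_by H (q x) (q y)) = \<one>\<^bsub>H\<^esub>"
      using xyz by (simp add: t G.star_jacobi del: q.hom_mult)
    show "conj_by H (q z) (q x \<star>\<^bsub>H\<^esub> q y) = conj_by H (q z) (q x) \<star>\<^bsub>H\<^esub> conj_by H (q z) (q y)"
      using xyz by (simp add: t G.conj_star del: q.hom_mult)
  qed
qed

lemma mlie_quot_sel [simp]:
  "carrier (mlie_quot G I) = rcosets\<^bsub>G\<^esub> I"
  "monoid.mult (mlie_quot G I) = set_mult G"
  "\<one>\<^bsub>mlie_quot G I\<^esub> = I"
  "C \<star>\<^bsub>mlie_quot G I\<^esub> D = (\<Union>x \<in> C. \<Union>y \<in> D. I #>\<^bsub>G\<^esub> (x \<star>\<^bsub>G\<^esub> y))"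
  by (simp_all add: mlie_quot_def)

context mult_lie_algebra
begin

lemma mlie_quot_star:
  assumes I: "mlie_ideal I G" and x: "x \<in> carrier G" and y: "y \<in> carrier G"
  shows "(\<Union>a \<in> I #> x. \<Union>b \<in> I #> y. I #> (a \<star> b)) = I #> (x \<star> y)"
proof -
  have "x \<in> I #> x" "y \<in> I #> y" using rcos_self mlie_idealD(2)[OF I] x y by auto
  then show ?thesis using star_rcoset[OF I x _ y] by blast
qed

text \<open>Carrier, product and unit are those of \<open>FactGroup\<close>; only the record type
  differs, so the group axioms are transferred by unfolding.\<close>

lemma mlie_quot_group:
  assumes "I \<lhd> G"
  shows "group (mlie_quot G I)"
  using normal.factorgroup_is_group[OF assms]
  by (simp add: group_def monoid_def group_axioms_def Units_def FactGroup_def)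

lemma mlie_quot_epi:
  assumes I: "mlie_ideal I G"
  shows "(\<lambda>x. I #> x) \<in> mlie_epi G (mlie_quot G I)"
proof -
  interpret normal I G by (rule mlie_idealD(1)[OF I])
  show ?thesis
    by (auto simp: mlie_epi_def mlie_hom_def hom_def mlie_quot_star[OF I] rcos_sum RCOSETS_def
        simp del: UN_simps)
qed

lemma mlie_quot_algebra:
  assumes I: "mlie_ideal I G"
  shows "mult_lie_algebra (mlie_quot G I)"
  by (rule mlie_algebra_epi_image[OF mult_lie_algebra_axioms mlie_quot_group mlie_quot_epi])
    (use I in \<open>auto dest: mlie_idealD\<close>)

text \<open>The bridge between centrality and commutator ideals: a coset is central exactly when the
  generators of \<open>mlie_comm\<close> formed with its representative fall into
  \<open>I\<close>.\<close>

lemma mlie_quot_center_iff: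
  assumes I: "mlie_ideal I G" and x: "x \<in> carrier G"
  shows "I #> x \<in> mlie_center (mlie_quot G I) \<longleftrightarrow>
    (\<forall>y \<in> carrier G. x \<star> y \<in> I \<and> x \<otimes> y \<otimes> inv x \<otimes> inv y \<in> I)"
proof -
  interpret normal I G by (rule mlie_idealD(1)[OF I])
  have 1: "I #> z = I \<longleftrightarrow> z \<in> I" if "z \<in> carrier G" for z
    using rcoset_eq_iff[OF subgroup_axioms that, of \<one>] that by (simp add: subset)
  have 2: "(I #> x) <#> (I #> y) = (I #> y) <#> (I #> x) \<longleftrightarrow> x \<otimes> y \<otimes> inv x \<otimes> inv y \<in> I"
    if y: "y \<in> carrier G" for y
    using x y by (simp add: rcos_sum rcoset_eq_iff[OF subgroup_axioms] inv_mult_group m_assoc)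
  have 3: "(\<Union>a \<in> I #> x. \<Union>b \<in> I #> y. I #> (a \<star> b)) = I \<longleftrightarrow> x \<star> y \<in> I" if "y \<in> carrier G" for y
    using 1 x that by (simp add: mlie_quot_star[OF I] del: UN_simps)
  show ?thesis
    using x unfolding mlie_center_iff mlie_quot_sel by (auto simp: RCOSETS_def 2 3)
qed

end

section \<open>Testing centrality in extensions, and preimages of ideals\<close>

lemma mlie_center_extensionI:
  assumes ext: "central_extension E \<phi> G" and c: "c \<in> carrier E"
    and T: "T \<subseteq> carrier E" "carrier G \<subseteq> \<phi> ` T"
    and comm: "\<And>t. t \<in> T \<Longrightarrow> c \<otimes>\<^bsub>E\<^esub> t = t \<otimes>\<^bsub>E\<^esub> c" and star: "\<And>t. t \<in> T \<Longrightarrow> c \<star>\<^bsub>E\<^esub> t = \<one>\<^bsub>E\<^esub>"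
  shows "c \<in> mlie_center E"
proof -
  have E: "mult_lie_algebra E" and G: "mult_lie_algebra G" and \<phi>: "\<phi> \<in> mlie_hom E G"
    and ker: "kernel E G \<phi> \<subseteq> mlie_center E"
    using ext by (auto simp: central_extension_def mlie_epi_def)
  interpret E: mult_lie_algebra E by (rule E)
  interpret G: mult_lie_algebra G by (rule G)
  interpret phi: group_hom E G \<phi> using mlie_homD(1)[OF \<phi>] by unfold_locales
  have "c \<otimes>\<^bsub>E\<^esub> e = e \<otimes>\<^bsub>E\<^esub> c \<and> c \<star>\<^bsub>E\<^esub> e = \<one>\<^bsub>E\<^esub>" if e: "e \<in> carrier E" for e
  proof -
    obtain t where t: "t \<in> T" "\<phi> e = \<phi> t" using T(2) e phi.hom_closed by blast
    have tc: "t \<in> carrier E" using t T by blast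
    \<comment> \<open>\<open>e\<close> and \<open>t\<close> have the same image, so \<open>e\<close>
      is \<open>t\<close> up to the factor \<open>z\<close> from the central kernel. Commuting with
      \<open>t\<close> and having trivial star with it thus carries over to
      \<open>e\<close>.\<close>
    define z where "z = e \<otimes>\<^bsub>E\<^esub> inv\<^bsub>E\<^esub> t"
    have zc: "z \<in> carrier E" and ez: "e = z \<otimes>\<^bsub>E\<^esub> t"
      using e tc by (simp_all add: z_def E.m_assoc)
    have "z \<in> kernel E G \<phi>" using e tc t by (simp add: z_def kernel_def)
    then have z: "z \<in> mlie_center E" using ker by blast
    have zcom: "z \<otimes>\<^bsub>E\<^esub> y = y \<otimes>\<^bsub>E\<^esub> z" if "y \<in> carrier E" for y
      using z that by (simp add: mlie_center_iff)
    have "c \<otimes>\<^bsub>E\<^esub> e = z \<otimes>\<^bsub>E\<^esub> (c \<otimes>\<^bsub>E\<^esub> t)"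
      unfolding ez using zcom[OF c] zc c tc by (metis E.m_assoc)
    also have "\<dots> = e \<otimes>\<^bsub>E\<^esub> c"
      unfolding ez comm[OF t(1)] using zc c tc by (simp add: E.m_assoc)
    finally have "c \<otimes>\<^bsub>E\<^esub> e = e \<otimes>\<^bsub>E\<^esub> c" .
    moreover have "c \<star>\<^bsub>E\<^esub> e = \<one>\<^bsub>E\<^esub>"
      unfolding ez using zc c tc star[OF t(1)]
      by (simp add: E.star_mult_right mlie_center_star_left[OF E z] conj_by_def)
    ultimately show ?thesis ..
  qed
  then show ?thesis using c by (simp add: mlie_center_iff)
qed

lemma mlie_ideal_vimage:
  assumes F: "mult_lie_algebra F" and G: "mult_lie_algebra G" and \<pi>: "\<pi> \<in> mlie_hom F G"
    and N: "mlie_ideal N G"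
  shows "mlie_ideal {x \<in> carrier F. \<pi> x \<in> N} F"
proof -
  interpret F: mult_lie_algebra F by (rule F)
  interpret G: mult_lie_algebra G by (rule G)
  interpret p: group_hom F G \<pi> using mlie_homD(1)[OF \<pi>] by unfold_locales
  interpret N: normal N G by (rule mlie_idealD(1)[OF N])
  have "subgroup {x \<in> carrier F. \<pi> x \<in> N} F"
    by (rule F.subgroupI) (auto intro: exI[of _ "\<one>\<^bsub>F\<^esub>"])
  then show ?thesis
    unfolding mlie_ideal_def F.normal_inv_iff
    using mlie_homD(2)[OF \<pi>] mlie_idealD(4)[OF N] N.inv_op_closed2 by auto
qed

lemma mlie_ideal_kernel:
  assumes F: "mult_lie_algebra F" and G: "mult_lie_algebra G" and \<pi>: "\<pi> \<in> mlie_hom F G"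
  shows "mlie_ideal (kernel F G \<pi>) F"
proof -
  interpret G: mult_lie_algebra G by (rule G)
  \<comment> \<open>Expanding the star of the product of two units with any element shows that the
    star of the unit with that element is idempotent, hence trivial.\<close>
  have "\<one>\<^bsub>G\<^esub> \<in> mlie_center G"
    using G.star_mult_left[OF G.one_closed G.one_closed]
    by (auto simp: mlie_center_iff conj_by_def)
  then have "x \<star>\<^bsub>G\<^esub> \<one>\<^bsub>G\<^esub> = \<one>\<^bsub>G\<^esub>" if "x \<in> carrier G" for x
    using mlie_center_star_left[OF G] that by blast
  then have "mlie_ideal {\<one>\<^bsub>G\<^esub>} G" by (simp add: mlie_ideal_def G.one_is_normal)
  from mlie_ideal_vimage[OF F G \<pi> this] show ?thesis by (simp add: kernel_def)
qed

section \<open>Schur multipliers and the map between them\<close>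

lemma (in mult_lie_algebra) carrier_schur_multiplier:
  "carrier (schur_multiplier G R) =
    (\<lambda>x. mlie_comm G R (carrier G) #> x) ` (mlie_comm G (carrier G) (carrier G) \<inter> R)"
  by (auto simp: schur_multiplier_def RCOSETS_def)

text \<open>As the smaller commutator ideal lies in the larger one, all elements of one coset of the
  former give the same coset of the latter, and the union in \<open>schur_map\<close>
  collapses.\<close>

lemma (in mult_lie_algebra) schur_map_rcoset:
  assumes R: "mlie_ideal R G" and S: "mlie_ideal S G" and RS: "R \<subseteq> S" and x: "x \<in> carrier G"
  shows "schur_map G S (mlie_comm G R (carrier G) #> x) = mlie_comm G S (carrier G) #> x"
proof -
  let ?MR = "mlie_comm G R (carrier G)" and ?MS = "mlie_comm G S (carrier G)"
  have sub: "subgroup ?MR G" "subgroup ?MS G"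
    using mlie_idealD(2)[OF mlie_comm_ideal] R S by auto
  have "?MR \<subseteq> ?MS"
    by (rule mlie_comm_mono) (use RS mlie_idealD(3)[OF S] sub in auto)
  then have "?MR #> x \<subseteq> ?MS #> x" by (auto simp: r_coset_def)
  then have "?MS #> y = ?MS #> x" if "y \<in> ?MR #> x" for y
    using repr_independence[OF _ x sub(2)] that by blast
  moreover have "x \<in> ?MR #> x" using rcos_self[OF x sub(1)] .
  ultimately show ?thesis unfolding schur_map_def by blast
qed

text \<open>By \<open>MSR\<close> and monotonicity, the ideal of \<open>S\<close> lies in the
  numerator of the multiplier for \<open>R\<close>. The kernel of the map is therefore the whole
  quotient of the two commutator ideals, which is trivial iff the inclusion holds.\<close>

lemma (in mult_lie_algebra) schur_map_mon_iff:
  assumes R: "mlie_ideal R G" and S: "mlie_ideal S G" and RS: "R \<subseteq> S"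
    and MSR: "mlie_comm G S (carrier G) \<subseteq> R"
  shows "schur_map G S \<in> mlie_mon (schur_multiplier G R) (schur_multiplier G S) \<longleftrightarrow>
    mlie_comm G S (carrier G) \<subseteq> mlie_comm G R (carrier G)"
proof -
  let ?MR = "mlie_comm G R (carrier G)" and ?MS = "mlie_comm G S (carrier G)"
  let ?M = "mlie_comm G (carrier G) (carrier G)"
  have I: "mlie_ideal ?MR G" "mlie_ideal ?MS G" "mlie_ideal ?M G"
    using mlie_comm_ideal R S mlie_ideal_carrier by auto
  note sub = I[THEN mlie_idealD(2)]
  interpret MR: normal ?MR G by (rule mlie_idealD(1)[OF I(1)])
  interpret MS: normal ?MS G by (rule mlie_idealD(1)[OF I(2)])
  have MSM: "?MS \<subseteq> ?M"
    by (rule mlie_comm_mono) (use mlie_idealD(3)[OF S] sub in auto)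
  have c: "x \<in> carrier G" if "x \<in> ?M" for x using that subgroup.subset[OF sub(3)] by blast
  \<comment> \<open>Restricting the carrier leaves the operations of \<open>G\<close> in place, so
    products and stars of cosets are those of the full quotient. \<open>R\<close> is rebound here to
    serve both multipliers.\<close>
  have mult: "monoid.mult (schur_multiplier G R) = set_mult G" for R
    by (intro ext) (simp add: schur_multiplier_def)
  have star: "C \<star>\<^bsub>schur_multiplier G R\<^esub> D = (\<Union>x \<in> C. \<Union>y \<in> D. mlie_comm G R (carrier G) #> (x \<star> y))"
    for R C D by (simp add: schur_multiplier_def)
  note sm = schur_map_rcoset[OF R S RS]
  have hom: "schur_map G S \<in> mlie_hom (schur_multiplier G R) (schur_multiplier G S)"
    unfolding mlie_hom_def hom_def carrier_schur_multiplier mult star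
    using RS c by (auto simp: sm MR.rcos_sum MS.rcos_sum mlie_quot_star[OF I(1)] mlie_quot_star[OF I(2)]
        simp del: UN_simps)
  have "inj_on (schur_map G S) (carrier (schur_multiplier G R)) \<longleftrightarrow>
      (\<forall>x \<in> ?M \<inter> R. \<forall>y \<in> ?M \<inter> R. ?MS #> x = ?MS #> y \<longrightarrow> ?MR #> x = ?MR #> y)"
    unfolding inj_on_def carrier_schur_multiplier using c by (simp add: sm)
  also have "\<dots> \<longleftrightarrow> ?MS \<subseteq> ?MR"
  proof
    assume inj: "\<forall>x \<in> ?M \<inter> R. \<forall>y \<in> ?M \<inter> R. ?MS #> x = ?MS #> y \<longrightarrow> ?MR #> x = ?MR #> y"
    show "?MS \<subseteq> ?MR"
    proof
      fix s assume s: "s \<in> ?MS"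
      \<comment> \<open>Injectivity is tested on \<open>s\<close> against \<open>\<one>\<close>,
        which represents the trivial coset.\<close>
      have "\<one> \<in> ?M \<inter> R" "s \<in> ?M \<inter> R"
        using s MSM MSR MS.one_closed by auto
      moreover have "?MS #> s = ?MS #> \<one>"
        using s MSM c by (simp add: rcoset_eq_iff[OF sub(2)])
      ultimately have "?MR #> s = ?MR #> \<one>" using inj by blast
      then show "s \<in> ?MR" using s MSM c by (auto simp: rcoset_eq_iff[OF sub(1)])
    qed
  next
    assume "?MS \<subseteq> ?MR"
    then show "\<forall>x \<in> ?M \<inter> R. \<forall>y \<in> ?M \<inter> R. ?MS #> x = ?MS #> y \<longrightarrow> ?MR #> x = ?MR #> y"
      using c by (auto simp: rcoset_eq_iff[OF sub(1)] rcoset_eq_iff[OF sub(2)])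
  qed
  finally show ?thesis using hom by (simp add: mlie_mon_def)
qed

section \<open>Commutator ideals and central extensions\<close>

lemma mlie_comm_subset_kernel:
  assumes F: "mult_lie_algebra F" and E: "mult_lie_algebra E" and h: "h \<in> mlie_hom F E"
    and S: "S \<subseteq> carrier F" "h ` S \<subseteq> mlie_center E"
  shows "mlie_comm F S (carrier F) \<subseteq> kernel F E h"
proof -
  interpret F: mult_lie_algebra F by (rule F)
  interpret E: mult_lie_algebra E by (rule E)
  interpret h: group_hom F E h using mlie_homD(1)[OF h] by unfold_locales
  show ?thesis
  proof (rule F.mlie_comm_least[OF h.subgroup_kernel])
    fix a b assume ab: "a \<in> S" "b \<in> carrier F"
    then have ac: "a \<in> carrier F" "h a \<in> mlie_center E" using S by auto
    then show "a \<star>\<^bsub>F\<^esub> b \<in> kernel F E h"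
      using ab mlie_homD(2)[OF h] by (simp add: kernel_def mlie_center_iff)
    show "a \<otimes>\<^bsub>F\<^esub> b \<otimes>\<^bsub>F\<^esub> inv\<^bsub>F\<^esub> a \<otimes>\<^bsub>F\<^esub> inv\<^bsub>F\<^esub> b \<in> kernel F E h"
      using ab ac E.commutator_eq_one_iff[of "h a" "h b"] by (auto simp: kernel_def mlie_center_iff)
  qed
qed

text \<open>Dividing \<open>F\<close> by \<open>M\<close> kills every star and commutator of the
  kernel of \<open>\<pi>\<close> with \<open>F\<close>, so the image of that kernel becomes central
  while \<open>\<pi>\<close> still factors through the quotient.\<close>

lemma central_extension_mlie_quot:
  assumes F: "mult_lie_algebra F" and G: "mult_lie_algebra G" and \<pi>: "\<pi> \<in> mlie_epi F G"
  defines "M \<equiv> mlie_comm F (kernel F G \<pi>) (carrier F)"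
  obtains \<psi> where "central_extension (mlie_quot F M) \<psi> G"
    "\<And>x. x \<in> carrier F \<Longrightarrow> \<psi> (M #>\<^bsub>F\<^esub> x) = \<pi> x"
proof -
  interpret F: mult_lie_algebra F by (rule F)
  interpret G: mult_lie_algebra G by (rule G)
  have \<pi>': "\<pi> \<in> mlie_hom F G" "\<pi> ` carrier F = carrier G" using \<pi> by (auto simp: mlie_epi_def)
  interpret p: group_hom F G \<pi> using mlie_homD(1)[OF \<pi>'(1)] by unfold_locales
  have R: "mlie_ideal (kernel F G \<pi>) F" by (rule mlie_ideal_kernel[OF F G \<pi>'(1)])
  have M: "mlie_ideal M F" unfolding M_def by (rule F.mlie_comm_ideal[OF R])
  have MR: "M \<subseteq> kernel F G \<pi>" unfolding M_def by (rule F.mlie_comm_subset_ideal[OF R])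
  interpret M: normal M F by (rule mlie_idealD(1)[OF M])
  \<comment> \<open>The choice of representative does not affect the value, because \<open>M\<close>
    lies in the kernel of \<open>\<pi>\<close>.\<close>
  define \<psi> where "\<psi> C = \<pi> (SOME x. x \<in> C)" for C
  have \<psi>: "\<psi> (M #>\<^bsub>F\<^esub> x) = \<pi> x" if x: "x \<in> carrier F" for x
  proof -
    have "(SOME y. y \<in> M #>\<^bsub>F\<^esub> x) \<in> M #>\<^bsub>F\<^esub> x"
      using F.rcos_self[OF x M.subgroup_axioms] by (rule someI)
    then obtain m where "m \<in> M" "(SOME y. y \<in> M #>\<^bsub>F\<^esub> x) = m \<otimes>\<^bsub>F\<^esub> x"
      by (auto simp: r_coset_def)
    then show ?thesis using MR x by (auto simp: \<psi>_def kernel_def)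
  qed
  have "\<psi> \<in> mlie_epi (mlie_quot F M) G"
    unfolding mlie_epi_def mlie_hom_def hom_def mlie_quot_sel
    using \<pi>'(2)[symmetric] mlie_homD(2)[OF \<pi>'(1)]
    by (auto simp: RCOSETS_def \<psi> M.rcos_sum F.mlie_quot_star[OF M] image_iff simp del: UN_simps)
  moreover have "kernel (mlie_quot F M) G \<psi> \<subseteq> mlie_center (mlie_quot F M)"
  proof
    fix C assume "C \<in> kernel (mlie_quot F M) G \<psi>"
    then obtain x where x: "x \<in> carrier F" "C = M #>\<^bsub>F\<^esub> x" "\<psi> C = \<one>\<^bsub>G\<^esub>"
      by (auto simp: kernel_def RCOSETS_def)
    then have "x \<in> kernel F G \<pi>" by (simp add: kernel_def \<psi>)
    then show "C \<in> mlie_center (mlie_quot F M)"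
      unfolding x(2) F.mlie_quot_center_iff[OF M x(1)]
      using F.mlie_comm_generators[OF mlie_idealD(3)[OF R] subset_refl] by (simp add: M_def)
  qed
  ultimately have "central_extension (mlie_quot F M) \<psi> G"
    using F.mlie_quot_algebra[OF M] G by (simp add: central_extension_def)
  then show ?thesis using \<psi> by (rule that)
qed

section \<open>Comparison of \<open>mlie_Zstar\<close> with the kernel of the induced map\<close>

theorem theorem4p23:
  fixes G :: "('a, 'm) mult_lie_scheme" and N :: "'a set"
    and F :: "('f, 'n) mult_lie_scheme" and \<pi> :: "'f \<Rightarrow> 'a" and R S :: "'f set"
  assumes "mult_lie_algebra G"
    and "central_ideal N G"
    and "free_presentation F \<pi> G"
    and "R = kernel F G \<pi>"
    and "S = {x \<in> carrier F. \<pi> x \<in> N}"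
  shows "N \<subseteq> mlie_Zstar G \<longleftrightarrow>
    schur_map F S \<in> mlie_mon (schur_multiplier F R) (schur_multiplier F S)"
proof -
  obtain X where free: "mlie_free_on X F" and pi: "\<pi> \<in> mlie_hom F G" "\<pi> ` carrier F = carrier G"
    and epi: "\<pi> \<in> mlie_epi F G"
    using assms(3) by (auto simp: free_presentation_def mlie_epi_def)
  have F: "mult_lie_algebra F" and X: "X \<subseteq> carrier F" using free by (auto simp: mlie_free_on_def)
  have N: "mlie_ideal N G" "N \<subseteq> mlie_center G" using assms(2) by (auto simp: central_ideal_def)
  interpret F: mult_lie_algebra F by (rule F)
  interpret G: mult_lie_algebra G by (rule assms(1))
  interpret p: group_hom F G \<pi> using mlie_homD(1)[OF pi(1)] by unfold_locales
  have R: "mlie_ideal R F"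
    unfolding assms(4) by (rule mlie_ideal_kernel[OF F assms(1) pi(1)])
  have S: "mlie_ideal S F"
    unfolding assms(5) by (rule mlie_ideal_vimage[OF F assms(1) pi(1) N(1)])
  have RS: "R \<subseteq> S"
    using subgroup.one_closed[OF mlie_idealD(2)[OF N(1)]] by (auto simp: assms(4,5) kernel_def)
  let ?MR = "mlie_comm F R (carrier F)" and ?MS = "mlie_comm F S (carrier F)"
  have I: "mlie_ideal ?MR F" by (rule F.mlie_comm_ideal[OF R])
  \<comment> \<open>Centrality of \<open>N\<close> enters here: \<open>\<pi>\<close> maps
    \<open>S\<close> into the center of \<open>G\<close>, so it kills the commutator ideal of
    \<open>S\<close>.\<close>
  have MSR: "?MS \<subseteq> R"
    unfolding assms(4)
    by (rule mlie_comm_subset_kernel[OF F assms(1) pi(1)]) (use N(2) in \<open>auto simp: assms(5)\<close>)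
  have "N \<subseteq> mlie_Zstar G \<longleftrightarrow> ?MS \<subseteq> ?MR"
  proof
    assume NZ: "N \<subseteq> mlie_Zstar G"
    obtain \<psi> where ext: "central_extension (mlie_quot F ?MR) \<psi> G"
      and \<psi>: "\<And>x. x \<in> carrier F \<Longrightarrow> \<psi> (?MR #>\<^bsub>F\<^esub> x) = \<pi> x"
      using central_extension_mlie_quot[OF F assms(1) epi] unfolding assms(4) by blast
    have central: "?MR #>\<^bsub>F\<^esub> s \<in> mlie_center (mlie_quot F ?MR)" if s: "s \<in> S" for s
    proof -
      let ?Q = "mlie_quot F ?MR"
      have sc: "s \<in> carrier F" "\<pi> s \<in> N" using s by (auto simp: assms(5))
      \<comment> \<open>The extension \<open>?Q\<close> is carried by \<open>'f set\<close>, hence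
        the appeal to \<open>mlie_Zstar_subset\<close> rather than to the definition.\<close>
      obtain C where C: "C \<in> mlie_center ?Q" "\<pi> s = \<psi> C"
        using NZ mlie_Zstar_subset[OF ext] sc by blast
      then obtain x where x: "x \<in> carrier F" "C = ?MR #>\<^bsub>F\<^esub> x"
        by (auto simp: mlie_center_iff RCOSETS_def)
      have "\<pi> s = \<pi> x" using C x \<psi> by simp
      \<comment> \<open>The coset of \<open>s\<close> differs from the central element
        \<open>C\<close> by the coset of an element of \<open>R\<close>, which is central as well;
        so it is a product of two central elements.\<close>
      then have "s \<otimes>\<^bsub>F\<^esub> inv\<^bsub>F\<^esub> x \<in> R" using sc x by (simp add: assms(4) kernel_def)
      then have z: "?MR #>\<^bsub>F\<^esub> (s \<otimes>\<^bsub>F\<^esub> inv\<^bsub>F\<^esub> x) \<in> mlie_center ?Q"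
        using F.mlie_comm_generators[OF mlie_idealD(3)[OF R] subset_refl] sc x
        by (simp add: F.mlie_quot_center_iff[OF I])
      interpret Q: mult_lie_algebra ?Q by (rule F.mlie_quot_algebra[OF I])
      have "?MR #>\<^bsub>F\<^esub> s = (?MR #>\<^bsub>F\<^esub> (s \<otimes>\<^bsub>F\<^esub> inv\<^bsub>F\<^esub> x)) \<otimes>\<^bsub>?Q\<^esub> C"
        using sc x normal.rcos_sum[OF mlie_idealD(1)[OF I]] by (simp add: F.m_assoc)
      also have "\<dots> \<in> mlie_center ?Q"
        by (rule Q.mlie_center_mult[OF z C(1)])
      finally show ?thesis .
    qed
    show "?MS \<subseteq> ?MR"
      by (rule F.mlie_comm_least[OF mlie_idealD(2)[OF I]])
        (use central F.mlie_quot_center_iff[OF I] mlie_idealD(3)[OF S] in blast)+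
  next
    assume MS: "?MS \<subseteq> ?MR"
    show "N \<subseteq> mlie_Zstar G"
    proof
      fix n assume n: "n \<in> N"
      have nc: "n \<in> carrier G" using n mlie_idealD(3)[OF N(1)] by blast
      then obtain s where s: "s \<in> carrier F" "n = \<pi> s" using pi(2) by blast
      have sS: "s \<in> S" using s n by (simp add: assms(5))
      have "n \<in> \<phi> ` mlie_center E" if ext: "central_extension E \<phi> G" for E :: "'a list mult_lie" and \<phi>
      proof -
        have E: "mult_lie_algebra E" and \<phi>: "\<phi> \<in> mlie_hom E G" "\<phi> ` carrier E = carrier G"
          and ker: "kernel E G \<phi> \<subseteq> mlie_center E"
          using ext by (auto simp: central_extension_def mlie_epi_def)
        interpret E: mult_lie_algebra E by (rule E)
        define g where "g x = inv_into (carrier E) \<phi> (\<pi> x)" for x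
        have g: "g x \<in> carrier E" "\<phi> (g x) = \<pi> x" if "x \<in> carrier F" for x
        proof -
          have "\<pi> x \<in> \<phi> ` carrier E" using that \<phi>(2) by simp
          then show "g x \<in> carrier E" "\<phi> (g x) = \<pi> x"
            unfolding g_def by (rule inv_into_into, rule f_inv_into_f)
        qed
        have "g \<in> X \<rightarrow> carrier E" using g X by auto
        then obtain h where h: "h \<in> mlie_hom F E" "\<forall>x \<in> X. h x = g x"
          using mlie_free_on_ex[OF free E] by blast
        \<comment> \<open>Both sides are homomorphisms on \<open>F\<close> that agree on the free
          generators \<open>X\<close>, by the choice of \<open>g\<close>.\<close>
        have \<phi>h: "\<phi> (h x) = \<pi> x" if "x \<in> carrier F" for x
          using mlie_free_on_unique[OF free assms(1) mlie_hom_compose[OF h(1) \<phi>(1)] pi(1) _ that]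
            h(2) g(2) X by auto
        interpret h: group_hom F E h using mlie_homD(1)[OF h(1)] by unfold_locales
        have "h ` R \<subseteq> mlie_center E"
          using ker \<phi>h by (auto simp: assms(4) kernel_def subset_iff)
        then have MRk: "?MR \<subseteq> kernel F E h"
          by (rule mlie_comm_subset_kernel[OF F E h(1) mlie_idealD(3)[OF R]])
        have "h s \<in> mlie_center E"
        \<comment> \<open>\<open>h\<close> may fail to be onto \<open>E\<close>, but its image
          covers \<open>G\<close> under \<open>\<phi>\<close>, so testing against that image
          suffices.\<close>
        proof (rule mlie_center_extensionI[OF ext, where T = "h ` carrier F"])
          show "carrier G \<subseteq> \<phi> ` h ` carrier F" using pi(2)[symmetric] \<phi>h by (auto simp: image_image)
          fix t assume "t \<in> h ` carrier F"
          then obtain f where f: "f \<in> carrier F" "t = h f" by blast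
          have k: "s \<star>\<^bsub>F\<^esub> f \<in> kernel F E h" "s \<otimes>\<^bsub>F\<^esub> f \<otimes>\<^bsub>F\<^esub> inv\<^bsub>F\<^esub> s \<otimes>\<^bsub>F\<^esub> inv\<^bsub>F\<^esub> f \<in> kernel F E h"
            using F.mlie_comm_generators[OF mlie_idealD(3)[OF S] subset_refl sS f(1)] MS MRk by auto
          show "h s \<star>\<^bsub>E\<^esub> t = \<one>\<^bsub>E\<^esub>"
            using k(1) mlie_homD(2)[OF h(1)] s f by (simp add: kernel_def)
          show "h s \<otimes>\<^bsub>E\<^esub> t = t \<otimes>\<^bsub>E\<^esub> h s"
            using k(2) s f by (simp add: kernel_def E.commutator_eq_one_iff)
        qed (use s in auto)
        then show ?thesis using \<phi>h s by force
      qed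
      then show "n \<in> mlie_Zstar G" using nc by (simp add: mlie_Zstar_def)
    qed
  qed
  also have "\<dots> \<longleftrightarrow> schur_map F S \<in> mlie_mon (schur_multiplier F R) (schur_multiplier F S)"
    by (rule F.schur_map_mon_iff[OF R S RS MSR, symmetric])
  finally show ?thesis .
qed

end
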